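(* Let $m\in\{0,1,2\}$ and let $\Sigma=(\sigma_{ij})$ be a positive definite real $p\times p$ matrix with $p\ge 2(m+1)$. Then $\Sigma\in F_{p,m}$ if and only if for every index set $A\subseteq\{1,\dots,p\}$ with $|A|=2(m+1)$, the principal submatrix $\Sigma_{A,A}=(\sigma_{ij})_{i,j\in A}$ belongs to $F_{2(m+1),m}$.
   Context: For integers $p\ge 1$, $m\ge 1$, $F_{p,m}=\{\Delta+\Gamma\Gamma^t : \Delta \text{ a positive definite diagonal } p\times p \text{ matrix},\ \Gamma\in\mathbb{R}^{p\times m}\}$ (the covariance matrices of the factor analysis model with $m$ factors). For $m=0$, $F_{p,0}$ is the set of positive definite diagonal $p\times p$ matrices. *)

theory Defs
  imports "Jordan_Normal_Form.Matrix" "Jordan_Normal_Form.DL_Submatrix"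
begin

definition pos_def_mat :: "nat \<Rightarrow> real mat \<Rightarrow> bool" where
  "pos_def_mat n S \<longleftrightarrow> S \<in> carrier_mat n n \<and> S\<^sup>T = S \<and>
     (\<forall>x \<in> carrier_vec n. x \<noteq> 0\<^sub>v n \<longrightarrow> x \<bullet> (S *\<^sub>v x) > 0)"

text \<open>Factor analysis model F_{p,m}. For m = 0, Gamma is p x 0 and Gamma Gamma^T = 0,
  so this is exactly the set of positive definite diagonal matrices.\<close>
definition factor_model :: "nat \<Rightarrow> nat \<Rightarrow> real mat set" where
  "factor_model p m = {\<Delta> + \<Gamma> * \<Gamma>\<^sup>T | \<Delta> \<Gamma>.
      pos_def_mat p \<Delta> \<and> diagonal_mat \<Delta> \<and> \<Gamma> \<in> carrier_mat p m}"

end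

theory Submission
  imports Defs
begin

text \<open>
  A matrix lies in F_{p,m} iff its off-diagonal entries are the inner products of vectors
  \<open>\<gamma>\<^sub>i\<close> in m-space with squared lengths less than the diagonal entries; so only the
  diagonal of a Gram matrix has to be completed.

  Suppose m = 2 and some minor with rows a, b and columns c, d (all distinct) is nonzero. Then
  \<open>\<gamma>\<^sub>a\<close>, \<open>\<gamma>\<^sub>b\<close> is a basis in any completion, and for every other i the coordinates
  (u, v) of \<open>\<gamma>\<^sub>i\<close> in it depend only on the given entries. Given vectors for a, b, c, d, all
  other vectors are therefore forced. The conditions to be checked either concern at most two
  further indices and none of the unknown lengths, or read
  \<open>\<sigma>\<^sub>i\<^sub>a = u |\<gamma>\<^sub>a|\<^sup>2 + v \<sigma>\<^sub>a\<^sub>b\<close> or \<open>\<sigma>\<^sub>i\<^sub>b = u \<sigma>\<^sub>a\<^sub>b + v |\<gamma>\<^sub>b|\<^sup>2\<close>. Each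
  of the latter fixes one of two unknowns or does not involve it, so one index for each unknown
  determines everything, and index sets of size 4 + 2 suffice. For m = 1 the same argument with a
  nonzero entry in place of the minor needs sets of size 2 + 2.

  If all these minors vanish for m = 2, consider the graph of nonzero off-diagonal entries. If it
  has two disjoint edges, the matrix has a rank one completion, and planarity on sets of size four
  shows that its diagonal is positive and small enough. Otherwise the graph is a triangle or a
  star; a star has at most two leaves, because its leaves are nonzero orthogonal vectors in the
  plane. In both cases one completes the at most three vertices involved and extends by zero.
\<close>

section \<open>Diagonal completion of a partial Gram matrix\<close>

text \<open>The index set is an arbitrary set, so that a principal submatrix is treated by
  restricting to a subset, without renumbering. The strict inequality leaves room for the positive
  diagonal matrix: its entries are the gaps between \<open>S i i\<close> and the squared
  lengths.\<close>

definition factorizes :: "nat \<Rightarrow> ('a \<Rightarrow> 'a \<Rightarrow> real) \<Rightarrow> 'a set \<Rightarrow> bool" where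
  "factorizes m S A \<longleftrightarrow> (\<exists>G :: 'a \<Rightarrow> nat \<Rightarrow> real. \<forall>i\<in>A.
     (\<Sum>k<m. (G i k)\<^sup>2) < S i i \<and>
     (\<forall>j\<in>A. j \<noteq> i \<longrightarrow> S i j = (\<Sum>k<m. G i k * G j k)))"

lemma factorizes_mono: "factorizes m S B \<Longrightarrow> A \<subseteq> B \<Longrightarrow> factorizes m S A"
  unfolding factorizes_def by blast

lemma factorizes_reindex:
  assumes "bij_betw f B A"
  shows "factorizes m (\<lambda>i j. S (f i) (f j)) B \<longleftrightarrow> factorizes m S A"
proof
  assume "factorizes m S A"
  then obtain G where G: "\<forall>i\<in>A. (\<Sum>k<m. (G i k)\<^sup>2) < S i i \<and>
     (\<forall>j\<in>A. j \<noteq> i \<longrightarrow> S i j = (\<Sum>k<m. G i k * G j k))"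
    unfolding factorizes_def by blast
  then show "factorizes m (\<lambda>i j. S (f i) (f j)) B"
    unfolding factorizes_def using assms
    by (intro exI[of _ "\<lambda>i. G (f i)"]) (auto simp: bij_betw_def inj_on_eq_iff)
next
  assume "factorizes m (\<lambda>i j. S (f i) (f j)) B"
  then obtain G where G: "\<forall>i\<in>B. (\<Sum>k<m. (G i k)\<^sup>2) < S (f i) (f i) \<and>
     (\<forall>j\<in>B. j \<noteq> i \<longrightarrow> S (f i) (f j) = (\<Sum>k<m. G i k * G j k))"
    unfolding factorizes_def by blast
  with assms show "factorizes m S A"
    unfolding factorizes_def
    by (intro exI[of _ "\<lambda>i. G (inv_into B f i)"])
      (auto simp: bij_betw_def inj_on_eq_iff)
qed

lemma factorizes_0: "factorizes 0 S A \<longleftrightarrow> (\<forall>i\<in>A. 0 < S i i \<and> (\<forall>j\<in>A. j \<noteq> i \<longrightarrow> S i j = 0))"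
  unfolding factorizes_def by simp

lemma factorizes_1I:
  assumes "\<And>i. i \<in> A \<Longrightarrow> (x i)\<^sup>2 < S i i"
    and "\<And>i j. i \<in> A \<Longrightarrow> j \<in> A \<Longrightarrow> j \<noteq> i \<Longrightarrow> S i j = x i * x j"
  shows "factorizes 1 S A"
  unfolding factorizes_def using assms by (intro exI[of _ "\<lambda>i k. x i"]) simp

lemma factorizes_1E:
  assumes "factorizes 1 S A"
  obtains x where "\<And>i. i \<in> A \<Longrightarrow> (x i)\<^sup>2 < S i i"
    and "\<And>i j. i \<in> A \<Longrightarrow> j \<in> A \<Longrightarrow> j \<noteq> i \<Longrightarrow> S i j = x i * x j"
proof -
  obtain G :: "'a \<Rightarrow> nat \<Rightarrow> real" where G: "\<forall>i\<in>A. (\<Sum>k<1. (G i k)\<^sup>2) < S i i \<and>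
     (\<forall>j\<in>A. j \<noteq> i \<longrightarrow> S i j = (\<Sum>k<1. G i k * G j k))"
    using assms unfolding factorizes_def by blast
  show thesis using G by (intro that[of "\<lambda>i. G i 0"]) simp_all
qed

lemma factorizes_2I:
  assumes "\<And>i. i \<in> A \<Longrightarrow> (x i)\<^sup>2 + (y i)\<^sup>2 < S i i"
    and "\<And>i j. i \<in> A \<Longrightarrow> j \<in> A \<Longrightarrow> j \<noteq> i \<Longrightarrow> S i j = x i * x j + y i * y j"
  shows "factorizes 2 S A"
proof -
  have "{..<2::nat} = {0, 1}" by auto
  then show ?thesis
    unfolding factorizes_def using assms
    by (intro exI[of _ "\<lambda>i k. if k = 0 then x i else y i"]) simp
qed

lemma factorizes_2E:
  assumes "factorizes 2 S A"
  obtains x y where "\<And>i. i \<in> A \<Longrightarrow> (x i)\<^sup>2 + (y i)\<^sup>2 < S i i"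
    and "\<And>i j. i \<in> A \<Longrightarrow> j \<in> A \<Longrightarrow> j \<noteq> i \<Longrightarrow> S i j = x i * x j + y i * y j"
proof -
  have eq: "{..<2::nat} = {0, 1}" by auto
  obtain G :: "'a \<Rightarrow> nat \<Rightarrow> real" where G: "\<forall>i\<in>A. (\<Sum>k<2. (G i k)\<^sup>2) < S i i \<and>
     (\<forall>j\<in>A. j \<noteq> i \<longrightarrow> S i j = (\<Sum>k<2. G i k * G j k))"
    using assms unfolding factorizes_def by blast
  show thesis using G by (intro that[of "\<lambda>i. G i 0" "\<lambda>i. G i 1"]) (simp_all add: eq)
qed

subsection \<open>Covariance matrices as partial Gram matrices\<close>

text \<open>The quadratic form is a sum of squares weighted by the diagonal entries. Unit vectors
  isolate the weights; conversely, one nonzero coordinate makes the sum positive.\<close>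

lemma pos_def_diagonal_mat_iff:
  assumes "D \<in> carrier_mat n n" "diagonal_mat D"
  shows "pos_def_mat n D \<longleftrightarrow> (\<forall>i<n. D $$ (i, i) > 0)"
proof -
  have mv: "(D *\<^sub>v x) $ i = D $$ (i, i) * x $ i" if "x \<in> carrier_vec n" "i < n" for x i
  proof -
    have "(D *\<^sub>v x) $ i = (\<Sum>j\<in>{0..<n}. D $$ (i, j) * x $ j)"
      using that assms(1) by (auto simp: scalar_prod_def)
    also have "\<dots> = (\<Sum>j\<in>{0..<n}. if j = i then D $$ (i, i) * x $ i else 0)"
      using that assms by (intro sum.cong) (auto simp: diagonal_mat_def)
    finally show ?thesis using that by simp
  qed
  have form: "x \<bullet> (D *\<^sub>v x) = (\<Sum>i\<in>{0..<n}. D $$ (i, i) * (x $ i)\<^sup>2)" if "x \<in> carrier_vec n" for x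
  proof -
    have "x \<bullet> (D *\<^sub>v x) = (\<Sum>i\<in>{0..<n}. x $ i * (D *\<^sub>v x) $ i)"
      using that assms(1) by (auto simp: scalar_prod_def)
    also have "\<dots> = (\<Sum>i\<in>{0..<n}. D $$ (i, i) * (x $ i)\<^sup>2)"
      by (intro sum.cong) (simp_all add: mv that power2_eq_square del: index_mult_mat_vec)
    finally show ?thesis .
  qed
  show ?thesis
  proof
    assume pd: "pos_def_mat n D"
    show "\<forall>i<n. D $$ (i, i) > 0"
    proof (intro allI impI)
      fix i assume i: "i < n"
      have "(\<Sum>j\<in>{0..<n}. D $$ (j, j) * (unit_vec n i $ j)\<^sup>2)
        = (\<Sum>j\<in>{0..<n}. if j = i then D $$ (i, i) else 0)"
        by (intro sum.cong) (auto simp: unit_vec_def)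
      then have "unit_vec n i \<bullet> (D *\<^sub>v unit_vec n i) = D $$ (i, i)"
        using i by (subst form) auto
      moreover have "unit_vec n i \<noteq> (0\<^sub>v n :: real vec)"
        using i by (metis index_unit_vec(1) index_zero_vec(1) zero_neq_one)
      ultimately show "D $$ (i, i) > 0"
        using pd unfolding pos_def_mat_def by (metis unit_vec_carrier)
    qed
  next
    assume pos: "\<forall>i<n. D $$ (i, i) > 0"
    have "D\<^sup>T = D"
    proof (rule eq_matI)
      fix i j assume ij: "i < dim_row D" "j < dim_col D"
      then show "D\<^sup>T $$ (i, j) = D $$ (i, j)"
        using assms by (cases "i = j") (auto simp: diagonal_mat_def)
    qed (use assms in auto)
    moreover have "x \<bullet> (D *\<^sub>v x) > 0" if x: "x \<in> carrier_vec n" "x \<noteq> 0\<^sub>v n" for x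
    proof -
      obtain i where i: "i < n" "x $ i \<noteq> 0"
        using x by (metis carrier_vecD eq_vecI index_zero_vec(1,2))
      have "0 < (\<Sum>i\<in>{0..<n}. D $$ (i, i) * (x $ i)\<^sup>2)"
        using i pos by (intro sum_pos2[of _ i]) (auto intro: less_imp_le)
      with form x show ?thesis by simp
    qed
    ultimately show "pos_def_mat n D"
      using assms unfolding pos_def_mat_def by blast
  qed
qed

text \<open>The rows of the loading matrix are the vectors, and the diagonal summand takes up what
  the squared lengths leave of the diagonal.\<close>

lemma factor_model_iff_factorizes:
  "S \<in> factor_model p m \<longleftrightarrow>
     S \<in> carrier_mat p p \<and> factorizes m (\<lambda>i j. S $$ (i, j)) {0..<p}"
proof
  assume "S \<in> factor_model p m"
  then obtain D C where S: "S = D + C * C\<^sup>T" and D: "pos_def_mat p D" "diagonal_mat D"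
    and C: "C \<in> carrier_mat p m"
    unfolding factor_model_def by blast
  from D have Dc: "D \<in> carrier_mat p p" unfolding pos_def_mat_def by blast
  have pos: "D $$ (i, i) > 0" if "i < p" for i
    using pos_def_diagonal_mat_iff[OF Dc D(2)] D(1) that by blast
  have ind: "S $$ (i, j) = D $$ (i, j) + (\<Sum>k<m. C $$ (i, k) * C $$ (j, k))"
    if "i < p" "j < p" for i j
    using that C Dc by (simp add: S scalar_prod_def atLeast0LessThan)
  have "factorizes m (\<lambda>i j. S $$ (i, j)) {0..<p}"
    unfolding factorizes_def using D(2) Dc pos
    by (intro exI[of _ "\<lambda>i k. C $$ (i, k)"]) (auto simp: ind diagonal_mat_def power2_eq_square)
  moreover have "S \<in> carrier_mat p p" using S C Dc by auto
  ultimately show "S \<in> carrier_mat p p \<and> factorizes m (\<lambda>i j. S $$ (i, j)) {0..<p}" by blast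
next
  assume asm: "S \<in> carrier_mat p p \<and> factorizes m (\<lambda>i j. S $$ (i, j)) {0..<p}"
  then obtain G :: "nat \<Rightarrow> nat \<Rightarrow> real" where
    "\<forall>i\<in>{0..<p}. (\<Sum>k<m. (G i k)\<^sup>2) < S $$ (i, i) \<and>
       (\<forall>j\<in>{0..<p}. j \<noteq> i \<longrightarrow> S $$ (i, j) = (\<Sum>k<m. G i k * G j k))"
    unfolding factorizes_def by blast
  then have
    G: "\<And>i. i < p \<Longrightarrow> (\<Sum>k<m. (G i k)\<^sup>2) < S $$ (i, i)"
       "\<And>i j. i < p \<Longrightarrow> j < p \<Longrightarrow> j \<noteq> i \<Longrightarrow> S $$ (i, j) = (\<Sum>k<m. G i k * G j k)"
    by auto
  define C where "C = mat p m (\<lambda>(i, k). G i k)"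
  define D where "D = mat p p (\<lambda>(i, j). if i = j then S $$ (i, i) - (\<Sum>k<m. (G i k)\<^sup>2) else 0)"
  have "pos_def_mat p D"
    by (subst pos_def_diagonal_mat_iff) (auto simp: D_def diagonal_mat_def G(1))
  moreover have "S = D + C * C\<^sup>T"
    using asm G(2)
    by (intro eq_matI)
      (auto simp: D_def C_def scalar_prod_def atLeast0LessThan power2_eq_square)
  moreover have "diagonal_mat D" "C \<in> carrier_mat p m"
    by (auto simp: D_def C_def diagonal_mat_def)
  ultimately show "S \<in> factor_model p m"
    unfolding factor_model_def by blast
qed

text \<open>\<open>submatrix\<close> renumbers the chosen rows by \<open>pick\<close>; this
  bijection undoes the renumbering.\<close>

lemma bij_betw_pick:
  assumes "finite A"
  shows "bij_betw (pick A) {0..<card A} A"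
proof -
  have "inj_on (pick A) {0..<card A}"
  proof (rule linorder_inj_onI)
    fix i j assume "i < j" "j \<in> {0..<card A}"
    then have "pick A i < pick A j" using pick_mono_le[of j A i] by simp
    then show "pick A i \<noteq> pick A j" by simp
  qed auto
  moreover have "pick A ` {0..<card A} \<subseteq> A"
    using pick_in_set_le by auto
  ultimately show ?thesis
    using assms by (simp add: bij_betw_def card_image card_subset_eq)
qed

lemma submatrix_factor_model_iff:
  assumes S: "S \<in> carrier_mat p p" and A: "A \<subseteq> {0..<p}"
  shows "submatrix S A A \<in> factor_model (card A) m \<longleftrightarrow> factorizes m (\<lambda>i j. S $$ (i, j)) A"
proof -
  have eq: "{i. i < p \<and> i \<in> A} = A" using A by auto
  have carr: "submatrix S A A \<in> carrier_mat (card A) (card A)"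
    using S by (intro carrier_matI) (auto simp: dim_submatrix eq)
  have ind: "submatrix S A A $$ (i, j) = S $$ (pick A i, pick A j)"
    if "i < card A" "j < card A" for i j
    using that S by (intro submatrix_index) (auto simp: eq)
  have "submatrix S A A \<in> factor_model (card A) m \<longleftrightarrow>
      factorizes m (\<lambda>i j. submatrix S A A $$ (i, j)) {0..<card A}"
    using carr by (simp add: factor_model_iff_factorizes)
  also have "\<dots> \<longleftrightarrow> factorizes m (\<lambda>i j. S $$ (pick A i, pick A j)) {0..<card A}"
    unfolding factorizes_def by (simp add: ind)
  also have "\<dots> \<longleftrightarrow> factorizes m (\<lambda>i j. S $$ (i, j)) A"
    using finite_subset[OF A] by (intro factorizes_reindex bij_betw_pick) simp
  finally show ?thesis .
qed

subsection \<open>A nonvanishing off-diagonal minor of order m\<close>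

text \<open>A smaller set is enlarged inside P to size n, and the factorization is restricted again.
  Later arguments can thus use sets such as \<open>{a, c, i, j}\<close> without excluding
  coincidences.\<close>

lemma factorizes_small_subsets:
  assumes "finite P" "n \<le> card P"
    and "\<And>A. A \<subseteq> P \<Longrightarrow> card A = n \<Longrightarrow> factorizes m S A"
    and "A \<subseteq> P" "card A \<le> n"
  shows "factorizes m S A"
proof -
  obtain B where "A \<subseteq> B" "B \<subseteq> P" "card B = n"
    using exists_subset_between[of A n P] assms by blast
  with assms(3) show ?thesis
    by (metis factorizes_mono)
qed

text \<open>The number at a is nonzero, so every other number is a multiple of it with a factor read
  off column c. Only the square of the number at a is unknown, and local completions are compared
  through it.\<close>

lemma factorizes_1_edge:
  fixes S :: "'a \<Rightarrow> 'a \<Rightarrow> real"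
  assumes loc: "\<And>A. A \<subseteq> P \<Longrightarrow> card A \<le> 4 \<Longrightarrow> factorizes 1 S A"
    and sym: "\<And>i j. i \<in> P \<Longrightarrow> j \<in> P \<Longrightarrow> S i j = S j i"
    and P: "a \<in> P" "c \<in> P" "a \<noteq> c" and nz: "S a c \<noteq> 0"
  shows "factorizes 1 S P"
proof -
  define Q where "Q = P - {a, c}"
  \<comment> \<open>In every completion \<open>u i\<close> is the ratio of the numbers at i and a,
    since their products with the number at c are given.\<close>
  define u where "u i = S i c / S a c" for i
  \<comment> \<open>The completion x depends on i and j, whereas the last equation contains only
    given entries. The case i = j is used below for single indices.\<close>
  have pair: "\<exists>x. (\<forall>k\<in>{a, c, i, j}. (x k)\<^sup>2 < S k k) \<and> S a c = x a * x c \<and>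
      (\<forall>k\<in>{i, j}. x k = u k * x a \<and> S k a = u k * (x a)\<^sup>2) \<and>
      (i \<noteq> j \<longrightarrow> S i j = u i * S a j)" if ij: "i \<in> Q" "j \<in> Q" for i j
  proof -
    have "card {a, c, i, j} \<le> 4" using card_length[of "[a, c, i, j]"] by simp
    moreover have sub: "{a, c, i, j} \<subseteq> P" using P ij by (auto simp: Q_def)
    ultimately have "factorizes 1 S {a, c, i, j}" by (intro loc)
    then obtain x where x: "\<And>k. k \<in> {a, c, i, j} \<Longrightarrow> (x k)\<^sup>2 < S k k"
      "\<And>k l. k \<in> {a, c, i, j} \<Longrightarrow> l \<in> {a, c, i, j} \<Longrightarrow> l \<noteq> k \<Longrightarrow> S k l = x k * x l"
      by (rule factorizes_1E) blast
    have ac: "S a c = x a * x c" using x P by simp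
    have coord: "x k = u k * x a \<and> S k a = u k * (x a)\<^sup>2" if "k \<in> {i, j}" for k
    proof -
      from that ij have k: "k \<in> {a, c, i, j}" "k \<noteq> a" "k \<noteq> c" by (auto simp: Q_def)
      then have "S k c = x k * x c" and ka: "S k a = x k * x a" using x by auto
      then have "x k = u k * x a" using nz ac by (auto simp: u_def)
      with ka show ?thesis by (simp add: power2_eq_square)
    qed
    have "S i j = u i * S a j" if "i \<noteq> j"
    proof -
      have "S i j = x i * x j" "S a j = x a * x j" using x that ij by (auto simp: Q_def)
      with coord[of i] show ?thesis by simp
    qed
    with x(1) ac coord show ?thesis
      by (intro exI[of _ x] conjI ballI impI) (assumption | blast)+
  qed
  show ?thesis
  proof (cases "Q = {}")
    case True
    then have "P = {a, c}" using P by (auto simp: Q_def)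
    then show ?thesis using loc[of P] card_length[of "[a, c]"] by simp
  next
    case False
    \<comment> \<open>\<open>u i0\<close> is nonzero if any factor is. Then the equation for i0
      determines the square of the number at a; otherwise no equation involves that square.\<close>
    then obtain i0 where i0: "i0 \<in> Q" "\<forall>i\<in>Q. u i0 = 0 \<longrightarrow> u i = 0" by blast
    from pair[OF i0(1) i0(1)] obtain x where
      x: "\<forall>k\<in>{a, c, i0}. (x k)\<^sup>2 < S k k" "S a c = x a * x c" "S i0 a = u i0 * (x a)\<^sup>2"
      by auto
    have diag: "S i a = u i * (x a)\<^sup>2" if "i \<in> Q" for i
    proof -
      from pair[OF that i0(1)] obtain z where
        z: "S i a = u i * (z a)\<^sup>2" "S i0 a = u i0 * (z a)\<^sup>2" by auto
      show ?thesis
      proof (cases "u i0 = 0")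
        case True with z i0 that show ?thesis by simp
      next
        case False with z x have "(z a)\<^sup>2 = (x a)\<^sup>2" by simp
        with z show ?thesis by simp
      qed
    qed
    \<comment> \<open>The square equals \<open>u i * S i a\<close>, a product of given quantities,
      so it agrees with the square in any local completion containing i, where the bound is
      known.\<close>
    have small: "(u i * x a)\<^sup>2 < S i i" if "i \<in> Q" for i
    proof -
      from pair[OF that that] obtain z where
        z: "(z i)\<^sup>2 < S i i" "z i = u i * z a" "S i a = u i * (z a)\<^sup>2" by auto
      have "(u i * x a)\<^sup>2 = u i * S i a" using diag[OF that] by (simp add: power2_eq_square)
      also have "\<dots> = (z i)\<^sup>2" using z by (simp add: power2_eq_square)
      finally show ?thesis using z by simp
    qed
    have off: "S i j = (u i * x a) * (u j * x a)" if "i \<in> Q" "j \<in> Q" "i \<noteq> j" for i j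
    proof -
      have "S i j = u i * S a j" using pair[OF that(1,2)] that(3) by blast
      moreover have "S a j = S j a" using sym that P by (auto simp: Q_def)
      ultimately show ?thesis using diag[OF that(2)] by (simp add: power2_eq_square)
    qed
    have offc: "S i c = (u i * x a) * x c" for i
      using nz x(2) by (simp add: u_def)
    define X where "X i = (if i \<in> {a, c} then x i else u i * x a)" for i
    have fromQ: "S k l = X k * X l" if "k \<in> Q" "l \<in> P" "l \<noteq> k" for k l
      using that diag[of k] off[of k l] offc[of k]
      by (auto simp: X_def Q_def power2_eq_square)
    show ?thesis
    proof (rule factorizes_1I[of _ X])
      show "(X i)\<^sup>2 < S i i" if "i \<in> P" for i
        using x small[of i] that by (auto simp: X_def Q_def)
      show "S i j = X i * X j" if ij: "i \<in> P" "j \<in> P" "j \<noteq> i" for i j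
      proof -
        consider "i \<in> Q" | "j \<in> Q" | "i \<in> {a, c}" "j \<in> {a, c}"
          using ij by (auto simp: Q_def)
        then show ?thesis
        proof cases
          case 1 then show ?thesis using fromQ ij by blast
        next
          case 2 then show ?thesis using fromQ[of j i] sym[of i j] ij by simp
        next
          case 3 then show ?thesis using ij x(2) sym[OF P(1,2)] by (auto simp: X_def)
        qed
      qed
    qed
  qed
qed

text \<open>Cramer's rule: the coordinates of the vector i in the basis a, b are read off its inner
  products with c and d, because M is the product of the determinants of (a, b) and (c, d).\<close>

lemma planar_coordinates:
  fixes xa ya xb yb xc yc xd yd xi yi :: real
  assumes "M = (xa*xc + ya*yc) * (xb*xd + yb*yd) - (xa*xd + ya*yd) * (xb*xc + yb*yc)" "M \<noteq> 0"
    and u: "u = ((xi*xc + yi*yc) * (xb*xd + yb*yd) - (xi*xd + yi*yd) * (xb*xc + yb*yc)) / M"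
    and v: "v = ((xa*xc + ya*yc) * (xi*xd + yi*yd) - (xa*xd + ya*yd) * (xi*xc + yi*yc)) / M"
  shows "xi = u*xa + v*xb" "yi = u*ya + v*yb"
proof -
  have M: "M = (xa*yb - ya*xb) * (xc*yd - yc*xd)"
    unfolding assms(1) by (simp add: algebra_simps)
  with assms(2) have nz: "xa*yb - ya*xb \<noteq> 0" "xc*yd - yc*xd \<noteq> 0" by auto
  have "((xi*xc + yi*yc) * (xb*xd + yb*yd) - (xi*xd + yi*yd) * (xb*xc + yb*yc))
      = (xi*yb - yi*xb) * (xc*yd - yc*xd)" by (simp add: algebra_simps)
  then have u': "u = (xi*yb - yi*xb) / (xa*yb - ya*xb)"
    using nz unfolding u M by simp
  have "((xa*xc + ya*yc) * (xi*xd + yi*yd) - (xa*xd + ya*yd) * (xi*xc + yi*yc))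
      = (xa*yi - ya*xi) * (xc*yd - yc*xd)" by (simp add: algebra_simps)
  then have v': "v = (xa*yi - ya*xi) / (xa*yb - ya*xb)"
    using nz unfolding v M by simp
  have "u*xa + v*xb = ((xi*yb - yi*xb) * xa + (xa*yi - ya*xi) * xb) / (xa*yb - ya*xb)"
    unfolding u' v' by (simp add: add_divide_distrib)
  also have "\<dots> = xi * (xa*yb - ya*xb) / (xa*yb - ya*xb)" by (simp add: algebra_simps)
  finally show "xi = u*xa + v*xb" using nz by simp
  have "u*ya + v*yb = ((xi*yb - yi*xb) * ya + (xa*yi - ya*xi) * yb) / (xa*yb - ya*xb)"
    unfolding u' v' by (simp add: add_divide_distrib)
  also have "\<dots> = yi * (xa*yb - ya*xb) / (xa*yb - ya*xb)" by (simp add: algebra_simps)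
  finally show "yi = u*ya + v*yb" using nz by simp
qed

text \<open>The scheme of \<open>factorizes_1_edge\<close> with basis a, b in place of a. The inner
  product of a and b is given, so the only unknowns in the equations to be compared are the two
  squared lengths.\<close>

lemma factorizes_2_nonzero_minor:
  fixes S :: "'a \<Rightarrow> 'a \<Rightarrow> real"
  assumes loc: "\<And>A. A \<subseteq> P \<Longrightarrow> card A \<le> 6 \<Longrightarrow> factorizes 2 S A"
    and sym: "\<And>i j. i \<in> P \<Longrightarrow> j \<in> P \<Longrightarrow> S i j = S j i"
    and P: "a \<in> P" "b \<in> P" "c \<in> P" "d \<in> P" and dist: "distinct [a, b, c, d]"
    and nz: "S a c * S b d - S a d * S b c \<noteq> 0"
  shows "factorizes 2 S P"
proof -
  define Q where "Q = P - {a, b, c, d}"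
  define M where "M = S a c * S b d - S a d * S b c"
  \<comment> \<open>Cramer's rule for the two linear equations that express the entries of i in
    columns c and d by those of a and b; M is the determinant.\<close>
  define u where "u i = (S i c * S b d - S i d * S b c) / M" for i
  define v where "v i = (S a c * S i d - S a d * S i c) / M" for i
  have M: "M \<noteq> 0" using nz by (simp add: M_def)
  \<comment> \<open>Completions on different six-element sets may use different vectors. They are
    compared only through given entries and the squared lengths of a and b.\<close>
  define completes where "completes x y A \<longleftrightarrow> {a, b, c, d} \<subseteq> A \<and>
      (\<forall>i\<in>A. (x i)\<^sup>2 + (y i)\<^sup>2 < S i i) \<and>
      (\<forall>i\<in>A. \<forall>j\<in>A. j \<noteq> i \<longrightarrow> S i j = x i * x j + y i * y j)" for x y A
  have entry: "S i j = x i * x j + y i * y j"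
    if "completes x y A" "i \<in> A" "j \<in> A" "i \<noteq> j" for x y A i j
    using that unfolding completes_def by metis
  have base: "S a b = x a * x b + y a * y b" "S a c = x a * x c + y a * y c"
      "S a d = x a * x d + y a * y d" "S b c = x b * x c + y b * y c"
      "S b d = x b * x d + y b * y d" if "completes x y A" for x y A
  proof -
    have "a \<in> A" "b \<in> A" "c \<in> A" "d \<in> A" using that by (auto simp: completes_def)
    with entry[OF that] dist show "S a b = x a * x b + y a * y b"
      "S a c = x a * x c + y a * y c" "S a d = x a * x d + y a * y d"
      "S b c = x b * x c + y b * y c" "S b d = x b * x d + y b * y d" by auto
  qed
  have pair: "\<exists>x y. completes x y {a, b, c, d, i, j}" if ij: "i \<in> Q" "j \<in> Q" for i j
  proof -
    have "card {a, b, c, d, i, j} \<le> 6" using card_length[of "[a, b, c, d, i, j]"] by simp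
    moreover have "{a, b, c, d, i, j} \<subseteq> P" using P ij by (auto simp: Q_def)
    ultimately have "factorizes 2 S {a, b, c, d, i, j}" by (intro loc)
    then obtain x y where xy: "\<And>k. k \<in> {a, b, c, d, i, j} \<Longrightarrow> (x k)\<^sup>2 + (y k)\<^sup>2 < S k k"
      "\<And>k l. k \<in> {a, b, c, d, i, j} \<Longrightarrow> l \<in> {a, b, c, d, i, j} \<Longrightarrow> l \<noteq> k \<Longrightarrow>
        S k l = x k * x l + y k * y l"
      by (rule factorizes_2E) blast
    have "completes x y {a, b, c, d, i, j}"
      unfolding completes_def
    proof (intro conjI ballI impI)
      show "{a, b, c, d} \<subseteq> {a, b, c, d, i, j}" by blast
    qed (use xy in \<open>assumption | blast\<close>)+
    then show ?thesis by blast
  qed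
  have coord: "x k = u k * x a + v k * x b" "y k = u k * y a + v k * y b"
    "S k a = u k * ((x a)\<^sup>2 + (y a)\<^sup>2) + v k * S a b"
    "S k b = u k * S a b + v k * ((x b)\<^sup>2 + (y b)\<^sup>2)"
    if xy: "completes x y A" and k: "k \<in> A" "k \<in> Q" for x y A k
  proof -
    note b = base[OF xy]
    have "a \<in> A" "b \<in> A" "c \<in> A" "d \<in> A" using xy by (auto simp: completes_def)
    moreover have "k \<noteq> a" "k \<noteq> b" "k \<noteq> c" "k \<noteq> d" using k by (auto simp: Q_def)
    ultimately have kk: "S k a = x k * x a + y k * y a" "S k b = x k * x b + y k * y b"
      "S k c = x k * x c + y k * y c" "S k d = x k * x d + y k * y d"
      using entry[OF xy k(1)] by auto
    show c: "x k = u k * x a + v k * x b" "y k = u k * y a + v k * y b"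
      by (rule planar_coordinates[OF M_def[unfolded b] M
            u_def[of k, unfolded b kk] v_def[of k, unfolded b kk]])+
    have "S k a = (u k * x a + v k * x b) * x a + (u k * y a + v k * y b) * y a"
      by (simp only: kk c[symmetric])
    then show "S k a = u k * ((x a)\<^sup>2 + (y a)\<^sup>2) + v k * S a b"
      by (simp add: b power2_eq_square algebra_simps)
    have "S k b = (u k * x a + v k * x b) * x b + (u k * y a + v k * y b) * y b"
      by (simp only: kk c[symmetric])
    then show "S k b = u k * S a b + v k * ((x b)\<^sup>2 + (y b)\<^sup>2)"
      by (simp add: b power2_eq_square algebra_simps)
  qed
  \<comment> \<open>Taking the inner product of the expansion of i with the vector j leaves only
    given entries, so the equation does not depend on the completion used.\<close>
  have cross: "S i j = u i * S a j + v i * S b j" if ij: "i \<in> Q" "j \<in> Q" "i \<noteq> j" for i j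
  proof -
    obtain x y where xy: "completes x y {a, b, c, d, i, j}" using pair[OF ij(1,2)] by blast
    have "a \<noteq> j" "b \<noteq> j" using ij by (auto simp: Q_def)
    then have e: "S i j = x i * x j + y i * y j" "S a j = x a * x j + y a * y j"
      "S b j = x b * x j + y b * y j" using entry[OF xy] ij(3) by auto
    have "S i j = (u i * x a + v i * x b) * x j + (u i * y a + v i * y b) * y j"
      unfolding e(1) using coord(1,2)[OF xy, of i] ij by simp
    then show ?thesis by (simp add: e(2,3) algebra_simps)
  qed
  show ?thesis
  proof (cases "Q = {}")
    case True
    then have "P = {a, b, c, d}" using P by (auto simp: Q_def)
    then show ?thesis using loc[of P] card_length[of "[a, b, c, d]"] by simp
  next
    case False
    then obtain i0 where i0: "i0 \<in> Q" "\<forall>i\<in>Q. u i0 = 0 \<longrightarrow> u i = 0" by blast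
    from False obtain j0 where j0: "j0 \<in> Q" "\<forall>i\<in>Q. v j0 = 0 \<longrightarrow> v i = 0" by blast
    \<comment> \<open>If no i has u i \<noteq> 0, then no constraint involves the squared length of a;
      otherwise i0 determines it. Likewise for v, j0 and b.\<close>
    obtain x y where xy: "completes x y {a, b, c, d, i0, j0}" using pair[OF i0(1) j0(1)] by blast
    \<comment> \<open>A completion containing both i and i0 has the right squared length at a by the
      equation for i0, unless \<open>u i0\<close> and hence \<open>u i\<close> vanishes.\<close>
    have diaga: "S i a = u i * ((x a)\<^sup>2 + (y a)\<^sup>2) + v i * S a b" if i: "i \<in> Q" for i
    proof -
      obtain z w where zw: "completes z w {a, b, c, d, i, i0}" using pair[OF i i0(1)] by blast
      have "S i0 a = u i0 * ((x a)\<^sup>2 + (y a)\<^sup>2) + v i0 * S a b"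
        using coord(3)[OF xy] i0(1) by blast
      moreover have z: "S i a = u i * ((z a)\<^sup>2 + (w a)\<^sup>2) + v i * S a b"
        "S i0 a = u i0 * ((z a)\<^sup>2 + (w a)\<^sup>2) + v i0 * S a b"
        using coord(3)[OF zw] i i0(1) by blast+
      ultimately have "u i0 = 0 \<or> (z a)\<^sup>2 + (w a)\<^sup>2 = (x a)\<^sup>2 + (y a)\<^sup>2" by simp
      with z(1) i0(2) i show ?thesis by auto
    qed
    have diagb: "S i b = u i * S a b + v i * ((x b)\<^sup>2 + (y b)\<^sup>2)" if i: "i \<in> Q" for i
    proof -
      obtain z w where zw: "completes z w {a, b, c, d, i, j0}" using pair[OF i j0(1)] by blast
      have "S j0 b = u j0 * S a b + v j0 * ((x b)\<^sup>2 + (y b)\<^sup>2)"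
        using coord(4)[OF xy] j0(1) by blast
      moreover have z: "S i b = u i * S a b + v i * ((z b)\<^sup>2 + (w b)\<^sup>2)"
        "S j0 b = u j0 * S a b + v j0 * ((z b)\<^sup>2 + (w b)\<^sup>2)"
        using coord(4)[OF zw] i j0(1) by blast+
      ultimately have "v j0 = 0 \<or> (z b)\<^sup>2 + (w b)\<^sup>2 = (x b)\<^sup>2 + (y b)\<^sup>2" by simp
      with z(1) j0(2) i show ?thesis by auto
    qed
    define X where "X i = (if i \<in> {a, b, c, d} then x i else u i * x a + v i * x b)" for i
    define Y where "Y i = (if i \<in> {a, b, c, d} then y i else u i * y a + v i * y b)" for i
    note base_xy = base[OF xy]
    \<comment> \<open>By bilinearity, every inner product with i reduces to inner products with a
      and b.\<close>
    have expand: "X i * X' + Y i * Y' = u i * (x a * X' + y a * Y') + v i * (x b * X' + y b * Y')"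
      if "i \<in> Q" for i X' Y'
      using that by (simp add: X_def Y_def Q_def algebra_simps)
    have offa: "S i a = X i * x a + Y i * y a" if "i \<in> Q" for i
      unfolding expand[OF that] diaga[OF that] base_xy by (simp add: power2_eq_square algebra_simps)
    have offb: "S i b = X i * x b + Y i * y b" if "i \<in> Q" for i
      unfolding expand[OF that] diagb[OF that] base_xy by (simp add: power2_eq_square algebra_simps)
    have offc: "S i c = X i * x c + Y i * y c" if "i \<in> Q" for i
    proof -
      \<comment> \<open>The terms with \<open>S i d\<close> cancel, and the factor of
        \<open>S i c\<close> is the minor M.\<close>
      have "u i * S a c + v i * S b c =
          ((S i c * S b d - S i d * S b c) * S a c + (S a c * S i d - S a d * S i c) * S b c) / M"
        by (simp add: u_def v_def add_divide_distrib)
      also have "\<dots> = S i c * M / M" by (simp add: M_def algebra_simps)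
      finally show ?thesis unfolding expand[OF that] base_xy[symmetric] using M by simp
    qed
    have offd: "S i d = X i * x d + Y i * y d" if "i \<in> Q" for i
    proof -
      have "u i * S a d + v i * S b d =
          ((S i c * S b d - S i d * S b c) * S a d + (S a c * S i d - S a d * S i c) * S b d) / M"
        by (simp add: u_def v_def add_divide_distrib)
      also have "\<dots> = S i d * M / M" by (simp add: M_def algebra_simps)
      finally show ?thesis unfolding expand[OF that] base_xy[symmetric] using M by simp
    qed
    have symQ: "S a i = S i a" "S b i = S i b" if "i \<in> Q" for i
      using that P by (auto simp: Q_def intro: sym)
    \<comment> \<open>The squared length is \<open>u i * S i a + v i * S i b\<close>, which is the
      same in a local completion containing i; that completion supplies the bound.\<close>
    have small: "(X i)\<^sup>2 + (Y i)\<^sup>2 < S i i" if i: "i \<in> Q" for i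
    proof -
      obtain z w where zw: "completes z w {a, b, c, d, i, i}" using pair[OF i i] by blast
      note z = coord[OF zw _ i, simplified] base[OF zw]
      have "(X i)\<^sup>2 + (Y i)\<^sup>2 = u i * (X i * x a + Y i * y a) + v i * (X i * x b + Y i * y b)"
        using expand[OF i, of "X i" "Y i"] by (simp add: power2_eq_square mult.commute)
      also have "\<dots> = u i * S i a + v i * S i b"
        using offa[OF i] offb[OF i] by simp
      also have "\<dots> = (z i)\<^sup>2 + (w i)\<^sup>2"
        unfolding z(1-5) by (simp add: power2_eq_square algebra_simps)
      also have "\<dots> < S i i" using zw by (simp add: completes_def)
      finally show ?thesis .
    qed
    have off: "S i j = X i * X j + Y i * Y j" if "i \<in> Q" "j \<in> Q" "i \<noteq> j" for i j
    proof -
      show ?thesis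
        unfolding expand[OF that(1)] cross[OF that] symQ[OF that(2)] offa[OF that(2)] offb[OF that(2)]
        by (simp add: mult.commute)
    qed
    have fromQ: "S k l = X k * X l + Y k * Y l" if kl: "k \<in> Q" "l \<in> P" "l \<noteq> k" for k l
    proof (cases "l \<in> Q")
      case True with off kl show ?thesis by simp
    next
      case False
      with kl have l: "l = a \<or> l = b \<or> l = c \<or> l = d" by (auto simp: Q_def)
      then have "X l = x l" "Y l = y l" by (auto simp: X_def Y_def)
      with l offa[OF kl(1)] offb[OF kl(1)] offc[OF kl(1)] offd[OF kl(1)]
      show ?thesis by auto
    qed
    show ?thesis
    proof (rule factorizes_2I[of _ X Y])
      show "(X i)\<^sup>2 + (Y i)\<^sup>2 < S i i" if "i \<in> P" for i
        using xy[unfolded completes_def] small[of i] that by (cases "i \<in> Q") (auto simp: X_def Y_def Q_def)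
      show "S i j = X i * X j + Y i * Y j" if ij: "i \<in> P" "j \<in> P" "j \<noteq> i" for i j
      proof -
        consider "i \<in> Q" | "j \<in> Q" | "i \<in> {a, b, c, d}" "j \<in> {a, b, c, d}"
          using ij by (auto simp: Q_def)
        then show ?thesis
        proof cases
          case 1 then show ?thesis using fromQ ij by blast
        next
          case 2 then show ?thesis using fromQ[of j i] sym[of i j] ij by (simp add: mult.commute)
        next
          case 3
          then have "X i = x i" "X j = x j" "Y i = y i" "Y j = y j" by (simp_all add: X_def Y_def)
          with entry[OF xy, of i j] 3 ij show ?thesis by auto
        qed
      qed
    qed
  qed
qed

subsection \<open>Vanishing tetrads\<close>

text \<open>A tetrad of planar vectors is a product of two determinants, so if all three vanish then
  at least three of the four vectors are parallel. The tetrads make the quotient independent of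
  the chosen pair, so the pair may be taken parallel; then it is the squared length of a
  projection of the vector 0.\<close>

lemma planar_tetrads_diagonal_bound:
  fixes x y :: "nat \<Rightarrow> real"
  assumes nz: "\<And>i j. i < 4 \<Longrightarrow> j < 4 \<Longrightarrow> i \<noteq> j \<Longrightarrow> T i j \<noteq> 0"
    and T: "\<And>i j. T i j = x i * x j + y i * y j"
    and t1: "T 0 1 * T 2 3 = T 0 2 * T 1 3" and t2: "T 0 1 * T 2 3 = T 0 3 * T 1 2"
  shows "0 < T 0 1 * T 0 2 / T 1 2 \<and> T 0 1 * T 0 2 / T 1 2 \<le> (x 0)\<^sup>2 + (y 0)\<^sup>2"
proof -
  \<comment> \<open>The determinant of the vectors i and j, zero exactly when they are
    parallel.\<close>
  define D where "D i j = x i * y j - y i * x j" for i j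
  have parallel: "0 < T 0 j * T 0 k / T j k \<and> T 0 j * T 0 k / T j k \<le> (x 0)\<^sup>2 + (y 0)\<^sup>2"
    if jk: "j \<in> {1, 2, 3}" "k \<in> {1, 2, 3}" "j \<noteq> k" and D0: "D j k = 0" for j k
  proof -
    have Tjk: "T j k \<noteq> 0" and T0j: "T 0 j \<noteq> 0" using jk nz by auto
    define N where "N = (x j)\<^sup>2 + (y j)\<^sup>2"
    have N: "N > 0" using Tjk T[of j k] by (auto simp: N_def sum_power2_gt_zero_iff)
    have "T 0 j * T j k - T 0 k * N = (x 0 * y j - y 0 * x j) * D j k"
      unfolding T N_def D_def by (simp add: power2_eq_square algebra_simps)
    then have e: "T 0 k * N = T 0 j * T j k" using D0 by simp
    have "T 0 j * T 0 k / T j k = T 0 j * (T 0 k * N) / (T j k * N)" using N by simp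
    also have "\<dots> = (T 0 j)\<^sup>2 / N" unfolding e using Tjk by (simp add: power2_eq_square)
    finally have q: "T 0 j * T 0 k / T j k = (T 0 j)\<^sup>2 / N" .
    \<comment> \<open>Lagrange's identity: the defect in the Cauchy-Schwarz inequality is a squared
      determinant.\<close>
    have "((x 0)\<^sup>2 + (y 0)\<^sup>2) * N - (T 0 j)\<^sup>2 = (x 0 * y j - y 0 * x j)\<^sup>2"
      unfolding T N_def by (simp add: power2_eq_square algebra_simps)
    then have "(T 0 j)\<^sup>2 \<le> ((x 0)\<^sup>2 + (y 0)\<^sup>2) * N" by (smt (verit) zero_le_power2)
    with q N T0j show ?thesis by (simp add: divide_le_eq)
  qed
  have "D 0 3 * D 1 2 = T 0 1 * T 2 3 - T 0 2 * T 1 3"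
    "D 0 2 * D 1 3 = T 0 1 * T 2 3 - T 0 3 * T 1 2"
    "D 0 1 * D 2 3 = T 0 2 * T 1 3 - T 0 3 * T 1 2"
    unfolding D_def T by (simp_all add: algebra_simps)
  then have d: "D 0 3 * D 1 2 = 0" "D 0 2 * D 1 3 = 0" "D 0 1 * D 2 3 = 0"
    using t1 t2 by auto
  \<comment> \<open>Otherwise the vector 0 would be parallel to the independent vectors 1 and 2,
    hence zero, contrary to \<open>T 0 1\<close> being nonzero.\<close>
  have "D 1 2 = 0 \<or> D 1 3 = 0 \<or> D 2 3 = 0"
  proof (rule ccontr)
    assume "\<not> ?thesis"
    with d have z: "D 0 1 = 0" "D 0 2 = 0" "D 1 2 \<noteq> 0" by auto
    have "x 0 * D 1 2 = x 1 * D 0 2 - x 2 * D 0 1" "y 0 * D 1 2 = y 1 * D 0 2 - y 2 * D 0 1"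
      unfolding D_def by (simp_all add: algebra_simps)
    with z have "x 0 = 0" "y 0 = 0" by auto
    with T[of 0 1] nz[of 0 1] show False by simp
  qed
  moreover have "T 0 1 * T 0 3 / T 1 3 = T 0 1 * T 0 2 / T 1 2"
    using nz[of 1 3] nz[of 1 2] t1 t2 by (simp add: field_simps)
  moreover have "T 0 2 * T 0 3 / T 2 3 = T 0 1 * T 0 2 / T 1 2"
    using nz[of 2 3] nz[of 1 2] t1 t2 by (simp add: field_simps)
  ultimately show ?thesis
    using parallel[of 1 2] parallel[of 1 3] parallel[of 2 3] by auto
qed

text \<open>The quotient is the diagonal entry at i that a rank one completion must have. It is at
  most the squared length of the planar vector at i, which is strictly below
  \<open>S i i\<close>.\<close>

lemma factorizes_2_tetrads_diagonal_bound:
  fixes S :: "'a \<Rightarrow> 'a \<Rightarrow> real"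
  assumes fac: "factorizes 2 S {i, j, k, l}" and dist: "distinct [i, j, k, l]"
    and nz: "S i j \<noteq> 0" "S i k \<noteq> 0" "S i l \<noteq> 0" "S j k \<noteq> 0" "S j l \<noteq> 0" "S k l \<noteq> 0"
    and t: "S i j * S k l = S i k * S j l" "S i j * S k l = S i l * S j k"
  shows "0 < S i j * S i k / S j k" "S i j * S i k / S j k < S i i"
proof -
  from fac obtain x y where xy: "\<And>p. p \<in> {i, j, k, l} \<Longrightarrow> (x p)\<^sup>2 + (y p)\<^sup>2 < S p p"
      "\<And>p q. p \<in> {i, j, k, l} \<Longrightarrow> q \<in> {i, j, k, l} \<Longrightarrow> q \<noteq> p \<Longrightarrow> S p q = x p * x q + y p * y q"
    by (rule factorizes_2E) blast
  define f where "f n = [i, j, k, l] ! n" for n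
  define T where "T p q = x (f p) * x (f q) + y (f p) * y (f q)" for p q
  have f: "f 0 = i" "f 1 = j" "f (Suc 0) = j" "f 2 = k" "f 3 = l" by (auto simp: f_def)
  have ST: "S i j = T 0 1" "S i k = T 0 2" "S i l = T 0 3" "S j k = T 1 2" "S j l = T 1 3"
    "S k l = T 2 3"
    using dist xy(2) unfolding T_def f by auto
  have T_sym: "T p q = T q p" for p q by (simp add: T_def mult.commute)
  have less4: "p < 4 \<Longrightarrow> p = 0 \<or> p = 1 \<or> p = 2 \<or> p = 3" for p :: nat by auto
  have "T p q \<noteq> 0" if "p < 4" "q < 4" "p \<noteq> q" for p q
    using less4[OF that(1)] less4[OF that(2)] that(3) nz[unfolded ST] T_sym by metis
  then have "0 < T 0 1 * T 0 2 / T 1 2 \<and> T 0 1 * T 0 2 / T 1 2 \<le> (x (f 0))\<^sup>2 + (y (f 0))\<^sup>2"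
    using t[unfolded ST]
    by (intro planar_tetrads_diagonal_bound[of T "\<lambda>n. x (f n)" "\<lambda>n. y (f n)"])
      (simp_all only: T_def)
  then show "0 < S i j * S i k / S j k" "S i j * S i k / S j k < S i i"
    using xy(1)[of i] unfolding ST f by auto
qed

text \<open>The tetrads turn the two disjoint edges into six nonzero entries on a, b, c, d. This
  fixes a rank one completion, whose diagonal is bounded on sets of size four.\<close>

lemma factorizes_2_zero_tetrads_disjoint_edges:
  fixes S :: "'a \<Rightarrow> 'a \<Rightarrow> real"
  assumes loc: "\<And>A. A \<subseteq> P \<Longrightarrow> card A \<le> 6 \<Longrightarrow> factorizes 2 S A"
    and sym: "\<And>i j. i \<in> P \<Longrightarrow> j \<in> P \<Longrightarrow> S i j = S j i"
    and tet: "\<And>i j k l. {i, j, k, l} \<subseteq> P \<Longrightarrow> distinct [i, j, k, l] \<Longrightarrow> S i k * S j l = S i l * S j k"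
    and P: "a \<in> P" "b \<in> P" "c \<in> P" "d \<in> P" and dist: "distinct [a, b, c, d]"
    and nz: "S a b \<noteq> 0" "S c d \<noteq> 0"
  shows "factorizes 2 S P"
proof -
  have tetrad: "S i j * S k l = S i k * S j l" "S i j * S k l = S i l * S j k"
    if "i \<in> P" "j \<in> P" "k \<in> P" "l \<in> P" "distinct [i, j, k, l]" for i j k l
    using tet[of i l j k] tet[of i k j l] that sym[of l k] sym[of j l] sym[of j k] by auto
  have four: "factorizes 2 S {i, j, k, l}" if "{i, j, k, l} \<subseteq> P" for i j k l
    using that card_length[of "[i, j, k, l]"] by (intro loc) auto
  have nz4: "S a c \<noteq> 0" "S a d \<noteq> 0" "S b c \<noteq> 0" "S b d \<noteq> 0"
    using tetrad[OF P dist] nz by auto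
  define r where "r = S a b * S a c / S b c"
  have r: "0 < r" "r < S a a"
    using factorizes_2_tetrads_diagonal_bound[OF four dist] P nz nz4 tetrad[OF P dist]
    by (auto simp: r_def)
  \<comment> \<open>r is the forced square of the number at a; its sign is free, and row a then
    determines all other numbers.\<close>
  define \<alpha> where "\<alpha> i = (if i = a then sqrt r else S a i / sqrt r)" for i
  have prod_a: "\<alpha> a * \<alpha> i = S a i" if "i \<noteq> a" for i
    using that r by (simp add: \<alpha>_def)
  \<comment> \<open>After multiplication by \<open>S b c\<close> this combines two tetrads. They
    need i different from c; if i = c, the roles of i and j are exchanged.\<close>
  have prod0: "S a i * S a j = r * S i j" if ij: "i \<in> P" "j \<in> P" "i \<noteq> j" "i \<noteq> a" "j \<noteq> a" for i j
  proof -
    have key: "S a i * S b c = S a b * S i c" if "i \<in> P" "i \<noteq> a" "i \<noteq> c" for i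
    proof (cases "i = b")
      case False
      then have "distinct [a, i, b, c]" using that dist by auto
      from tetrad(1)[OF _ _ _ _ this] that P show ?thesis by simp
    qed simp
    have *: "S a i * S a j * S b c = S a b * S a c * S i j"
      if ij: "i \<in> P" "j \<in> P" "i \<noteq> j" "i \<noteq> a" "j \<noteq> a" "i \<noteq> c" for i j
    proof -
      have "S a j * S i c = S a c * S i j"
      proof (cases "j = c")
        case False
        then have "distinct [a, j, i, c]" using ij dist by auto
        from tetrad(2)[OF _ _ _ _ this] ij P show ?thesis using sym[of i j] by simp
      qed simp
      moreover have "S a i * S a j * S b c = S a b * (S a j * S i c)"
        using key[of i] ij by (simp add: mult.commute mult.left_commute)
      ultimately show ?thesis by simp
    qed
    have "S a i * S a j * S b c = S a b * S a c * S i j"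
    proof (cases "i = c")
      case True
      then show ?thesis using *[of j i] ij sym[of i j] by (simp add: mult.commute mult.left_commute)
    qed (use * ij in blast)
    then show ?thesis using nz4 by (simp add: r_def field_simps)
  qed
  have prod: "S i j = \<alpha> i * \<alpha> j" if ij: "i \<in> P" "j \<in> P" "j \<noteq> i" for i j
  proof (cases "i = a \<or> j = a")
    case True
    then show ?thesis using prod_a[of i] prod_a[of j] ij sym[of i j] by (auto simp: mult.commute)
  next
    case False
    have "\<alpha> i * \<alpha> j = S a i * S a j / r" using False r by (simp add: \<alpha>_def)
    also have "\<dots> = S i j" using prod0[of i j] False ij r by simp
    finally show ?thesis by simp
  qed
  have bound: "(\<alpha> i)\<^sup>2 < S i i"
    if "i \<in> P" "j \<in> P" "k \<in> P" "l \<in> P" "distinct [i, j, k, l]"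
      "\<alpha> i \<noteq> 0" "\<alpha> j \<noteq> 0" "\<alpha> k \<noteq> 0" "\<alpha> l \<noteq> 0" for i j k l
  proof -
    have "S i j * S i k / S j k < S i i"
      using that by (intro factorizes_2_tetrads_diagonal_bound(2)[OF four that(5)] tetrad that(5))
        (auto simp: prod)
    moreover have "S i j * S i k / S j k = (\<alpha> i)\<^sup>2"
      using that by (auto simp: prod power2_eq_square)
    ultimately show ?thesis by simp
  qed
  have \<alpha>4: "\<alpha> a \<noteq> 0" "\<alpha> b \<noteq> 0" "\<alpha> c \<noteq> 0" "\<alpha> d \<noteq> 0"
    using nz nz4 dist r by (auto simp: \<alpha>_def)
  have small: "(\<alpha> i)\<^sup>2 + 0\<^sup>2 < S i i" if i: "i \<in> P" for i
  proof (cases "\<alpha> i = 0")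
    case True
    from four[of i i i i] i obtain x y where "(x i)\<^sup>2 + (y i)\<^sup>2 < S i i"
      by (auto elim!: factorizes_2E)
    then have "0 < S i i" by (smt (verit) zero_le_power2)
    with True show ?thesis by simp
  next
    case False
    \<comment> \<open>Three of a, b, c, d different from i complete i to four indices with nonzero
      numbers.\<close>
    consider "i = a" | "i = b" | "i = c" | "i \<notin> {a, b, c}" by auto
    then have "(\<alpha> i)\<^sup>2 < S i i"
    proof cases
      case 1 then show ?thesis using bound[of i b c d] P dist \<alpha>4 by auto
    next
      case 2 then show ?thesis using bound[of i a c d] P dist \<alpha>4 by auto
    next
      case 3 then show ?thesis using bound[of i a b d] P dist \<alpha>4 by auto
    next
      case 4 then show ?thesis using bound[of i a b c] P dist \<alpha>4 i False by auto
    qed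
    then show ?thesis by simp
  qed
  show ?thesis
    by (rule factorizes_2I[of _ \<alpha> "\<lambda>_. 0"]) (use small prod in auto)
qed

section \<open>Triangles and stars of nonzero entries\<close>

lemma factorizes_2_extend_by_zero:
  fixes S :: "'a \<Rightarrow> 'a \<Rightarrow> real"
  assumes fac: "factorizes 2 S T" and pos: "\<And>i. i \<in> P \<Longrightarrow> 0 < S i i"
    and zero: "\<And>i j. i \<in> P \<Longrightarrow> j \<in> P \<Longrightarrow> j \<noteq> i \<Longrightarrow> i \<notin> T \<or> j \<notin> T \<Longrightarrow> S i j = 0"
  shows "factorizes 2 S P"
proof -
  from fac obtain x y where xy: "\<And>i. i \<in> T \<Longrightarrow> (x i)\<^sup>2 + (y i)\<^sup>2 < S i i"
      "\<And>i j. i \<in> T \<Longrightarrow> j \<in> T \<Longrightarrow> j \<noteq> i \<Longrightarrow> S i j = x i * x j + y i * y j"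
    by (rule factorizes_2E) blast
  show ?thesis
    by (rule factorizes_2I[of _ "\<lambda>i. if i \<in> T then x i else 0" "\<lambda>i. if i \<in> T then y i else 0"])
      (use xy pos zero in auto)
qed

text \<open>Three nonzero vectors in the plane cannot be pairwise orthogonal: k is orthogonal to i
  and j, so these two are parallel as well as orthogonal, and one of them is zero.\<close>

lemma factorizes_2_star_leaves:
  fixes S :: "'a \<Rightarrow> 'a \<Rightarrow> real"
  assumes fac: "factorizes 2 S {a, i, j, k}" and dist: "distinct [a, i, j, k]"
    and zero: "S i j = 0" "S i k = 0" "S j k = 0"
  shows "S a i = 0 \<or> S a j = 0 \<or> S a k = 0"
proof (rule ccontr)
  assume nz: "\<not> ?thesis"
  from fac obtain x y where "\<And>p. p \<in> {a, i, j, k} \<Longrightarrow> (x p)\<^sup>2 + (y p)\<^sup>2 < S p p"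
      and xy: "\<And>p q. p \<in> {a, i, j, k} \<Longrightarrow> q \<in> {a, i, j, k} \<Longrightarrow> q \<noteq> p \<Longrightarrow> S p q = x p * x q + y p * y q"
    by (rule factorizes_2E) blast
  have o: "x i * x j + y i * y j = 0" "x i * x k + y i * y k = 0" "x j * x k + y j * y k = 0"
    using xy[of i j] xy[of i k] xy[of j k] dist zero by auto
  have n: "x p \<noteq> 0 \<or> y p \<noteq> 0" if "p \<in> {i, j, k}" for p
    using xy[of a p] that nz dist by auto
  have D: "(x i * y j - y i * x j) * x k = y j * (x i * x k + y i * y k) - y i * (x j * x k + y j * y k)"
    "(x i * y j - y i * x j) * y k = x i * (x j * x k + y j * y k) - x j * (x i * x k + y i * y k)"
    by (simp_all add: algebra_simps)
  have "x i * y j - y i * x j = 0" using D o n[of k] by auto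
  moreover have "((x i)\<^sup>2 + (y i)\<^sup>2) * ((x j)\<^sup>2 + (y j)\<^sup>2)
      = (x i * x j + y i * y j)\<^sup>2 + (x i * y j - y i * x j)\<^sup>2"
    by (simp add: power2_eq_square algebra_simps)
  ultimately have "((x i)\<^sup>2 + (y i)\<^sup>2) * ((x j)\<^sup>2 + (y j)\<^sup>2) = 0" using o by simp
  then show False using n[of i] n[of j] by (auto simp: sum_power2_eq_zero_iff)
qed

text \<open>At most two leaves exist, so the centre and its leaves fit into a small set; all other
  indices are isolated.\<close>

lemma factorizes_2_star:
  fixes S :: "'a \<Rightarrow> 'a \<Rightarrow> real"
  assumes loc: "\<And>A. A \<subseteq> P \<Longrightarrow> card A \<le> 6 \<Longrightarrow> factorizes 2 S A"
    and sym: "\<And>i j. i \<in> P \<Longrightarrow> j \<in> P \<Longrightarrow> S i j = S j i"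
    and pos: "\<And>i. i \<in> P \<Longrightarrow> 0 < S i i"
    and a: "a \<in> P"
    and star: "\<And>i j. i \<in> P \<Longrightarrow> j \<in> P \<Longrightarrow> i \<noteq> j \<Longrightarrow> S i j \<noteq> 0 \<Longrightarrow> i = a \<or> j = a"
  shows "factorizes 2 S P"
proof -
  define N where "N = {i \<in> P. i \<noteq> a \<and> S a i \<noteq> 0}"
  have "card N \<le> 2"
  proof (rule ccontr)
    assume "\<not> ?thesis"
    then obtain B where "B \<subseteq> N" "card B = 3"
      by (metis not_less_eq_eq numeral_2_eq_2 numeral_3_eq_3 obtain_subset_with_card_n)
    then obtain i j k where ijk: "i \<in> N" "j \<in> N" "k \<in> N" "i \<noteq> j" "i \<noteq> k" "j \<noteq> k"
      by (auto simp: card_3_iff)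
    have "factorizes 2 S {a, i, j, k}"
      using ijk a card_length[of "[a, i, j, k]"] by (intro loc) (auto simp: N_def)
    from factorizes_2_star_leaves[OF this] ijk star[of i j] star[of i k] star[of j k]
    show False by (auto simp: N_def)
  qed
  then have "card (insert a N) \<le> 6"
    using card_insert_le_m1[of 6 N a] by simp
  then have "factorizes 2 S (insert a N)"
    using a by (intro loc) (auto simp: N_def)
  then show ?thesis
  proof (rule factorizes_2_extend_by_zero)
    fix i j assume ij: "i \<in> P" "j \<in> P" "j \<noteq> i" "i \<notin> insert a N \<or> j \<notin> insert a N"
    show "S i j = 0"
    proof (rule ccontr)
      assume "S i j \<noteq> 0"
      then have "i \<in> insert a N \<and> j \<in> insert a N"
        using star[of i j] sym[of i j] ij(1-3) by (auto simp: N_def)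
      with ij(4) show False by blast
    qed
  qed (rule pos)
qed

lemma factorizes_2_local:
  fixes S :: "'a \<Rightarrow> 'a \<Rightarrow> real"
  assumes loc: "\<And>A. A \<subseteq> P \<Longrightarrow> card A \<le> 6 \<Longrightarrow> factorizes 2 S A"
    and sym: "\<And>i j. i \<in> P \<Longrightarrow> j \<in> P \<Longrightarrow> S i j = S j i"
  shows "factorizes 2 S P"
proof (cases "\<exists>i\<in>P. \<exists>j\<in>P. \<exists>k\<in>P. \<exists>l\<in>P. distinct [i, j, k, l] \<and> S i k * S j l - S i l * S j k \<noteq> 0")
  case True
  then obtain i j k l where "i \<in> P" "j \<in> P" "k \<in> P" "l \<in> P" "distinct [i, j, k, l]"
    "S i k * S j l - S i l * S j k \<noteq> 0" by blast
  then show ?thesis by (intro factorizes_2_nonzero_minor[OF loc sym])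
next
  case False
  have tet: "S i k * S j l = S i l * S j k" if "{i, j, k, l} \<subseteq> P" "distinct [i, j, k, l]" for i j k l
    using False that by (metis eq_iff_diff_eq_0 insert_subset)
  have pos: "0 < S i i" if i: "i \<in> P" for i
  proof -
    from loc[of "{i}"] i obtain x y where "(x i)\<^sup>2 + (y i)\<^sup>2 < S i i"
      by (auto elim!: factorizes_2E)
    then show ?thesis by (smt (verit) zero_le_power2)
  qed
  define E where "E i j \<longleftrightarrow> i \<in> P \<and> j \<in> P \<and> i \<noteq> j \<and> S i j \<noteq> 0" for i j
  have E_sym: "E i j \<Longrightarrow> E j i" for i j using sym by (auto simp: E_def)
  show ?thesis
  proof (cases "\<exists>a b c d. E a b \<and> E c d \<and> distinct [a, b, c, d]")
    case True
    then obtain a b c d where "a \<in> P" "b \<in> P" "c \<in> P" "d \<in> P" "distinct [a, b, c, d]"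
      "S a b \<noteq> 0" "S c d \<noteq> 0" unfolding E_def by blast
    then show ?thesis by (intro factorizes_2_zero_tetrads_disjoint_edges[OF loc sym tet])
  next
    case False
    then have meet: "{i, j} \<inter> {k, l} \<noteq> {}" if "E i j" "E k l" for i j k l
      using that unfolding E_def by fastforce
    show ?thesis
    proof (cases "\<exists>a b c. E a b \<and> E b c \<and> E a c")
      case True
      then obtain a b c where abc: "E a b" "E b c" "E a c" by blast
      have "factorizes 2 S {a, b, c}"
        using abc card_length[of "[a, b, c]"] by (intro loc) (auto simp: E_def)
      then show ?thesis
      proof (rule factorizes_2_extend_by_zero)
        fix i j assume ij: "i \<in> P" "j \<in> P" "j \<noteq> i" "i \<notin> {a, b, c} \<or> j \<notin> {a, b, c}"
        show "S i j = 0"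
        proof (rule ccontr)
          \<comment> \<open>An edge with an endpoint outside the triangle contains at most one of
            its vertices and misses the opposite side.\<close>
          assume "S i j \<noteq> 0"
          with ij have "E i j" by (simp add: E_def)
          from meet[OF this abc(1)] meet[OF this abc(2)] meet[OF this abc(3)] ij abc
          show False by (auto simp: E_def)
        qed
      qed (rule pos)
    next
      case no_triangle: False
      show ?thesis
      proof (cases "\<exists>a b. E a b")
        case True
        then obtain a b where ab: "E a b" by blast
        \<comment> \<open>An edge avoiding a meets ab in b and leads to some c; an edge avoiding b
          leads from a to some e. These two edges meet, so c = e, which closes a triangle.\<close>
        have "(\<forall>i j. E i j \<longrightarrow> i = a \<or> j = a) \<or> (\<forall>i j. E i j \<longrightarrow> i = b \<or> j = b)"
        proof (rule ccontr)
          assume "\<not> ?thesis"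
          then obtain i j k l where ij: "E i j" "i \<noteq> a" "j \<noteq> a" and kl: "E k l" "k \<noteq> b" "l \<noteq> b"
            by blast
          obtain c where c: "E b c" "c \<noteq> a" using meet[OF ij(1) ab] ij E_sym by auto
          obtain e where e: "E a e" "e \<noteq> b" using meet[OF kl(1) ab] kl E_sym by auto
          have "c = e" using meet[OF c(1) e(1)] c e ab by (auto simp: E_def)
          with no_triangle ab c e show False by blast
        qed
        then show ?thesis
        proof
          assume "\<forall>i j. E i j \<longrightarrow> i = a \<or> j = a"
          with ab show ?thesis
            by (intro factorizes_2_star[OF loc sym pos, where a = a]) (auto simp: E_def)
        next
          assume "\<forall>i j. E i j \<longrightarrow> i = b \<or> j = b"
          with ab show ?thesis
            by (intro factorizes_2_star[OF loc sym pos, where a = b]) (auto simp: E_def)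
        qed
      next
        case False
        then show ?thesis
          using pos by (intro factorizes_2I[of _ "\<lambda>_. 0" "\<lambda>_. 0"]) (auto simp: E_def)
      qed
    qed
  qed
qed

section \<open>The cases m = 1 and m = 0, and the theorem\<close>

lemma factorizes_1_local:
  fixes S :: "'a \<Rightarrow> 'a \<Rightarrow> real"
  assumes loc: "\<And>A. A \<subseteq> P \<Longrightarrow> card A \<le> 4 \<Longrightarrow> factorizes 1 S A"
    and sym: "\<And>i j. i \<in> P \<Longrightarrow> j \<in> P \<Longrightarrow> S i j = S j i"
  shows "factorizes 1 S P"
proof (cases "\<exists>a\<in>P. \<exists>c\<in>P. a \<noteq> c \<and> S a c \<noteq> 0")
  case True
  then obtain a c where "a \<in> P" "c \<in> P" "a \<noteq> c" "S a c \<noteq> 0" by blast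
  then show ?thesis by (intro factorizes_1_edge[OF loc sym])
next
  case False
  show ?thesis
  proof (rule factorizes_1I[of _ "\<lambda>_. 0"])
    fix i assume i: "i \<in> P"
    have "factorizes 1 S {i}" using i by (intro loc) auto
    then obtain x where "(x i)\<^sup>2 < S i i"
      by (rule factorizes_1E) blast
    then show "0\<^sup>2 < S i i" by (smt (verit) zero_le_power2 zero_power2)
  qed (use False in auto)
qed

lemma factorizes_0_local:
  assumes loc: "\<And>A. A \<subseteq> P \<Longrightarrow> card A \<le> 2 \<Longrightarrow> factorizes 0 S A"
  shows "factorizes 0 S P"
  unfolding factorizes_0
proof (intro ballI conjI impI)
  fix i assume i: "i \<in> P"
  show "0 < S i i" using loc[of "{i}"] i by (simp add: factorizes_0)
  fix j assume "j \<in> P" "j \<noteq> i"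
  then show "S i j = 0" using loc[of "{i, j}"] i by (simp add: factorizes_0)
qed

theorem theorem1:
  fixes p m :: nat and \<Sigma> :: "real mat"
  assumes "m \<le> 2"
    and "pos_def_mat p \<Sigma>"
    and "p \<ge> 2 * (m + 1)"
  shows "\<Sigma> \<in> factor_model p m \<longleftrightarrow>
    (\<forall>A. A \<subseteq> {0..<p} \<and> card A = 2 * (m + 1) \<longrightarrow>
         submatrix \<Sigma> A A \<in> factor_model (2 * (m + 1)) m)"
proof -
  define S where "S = (\<lambda>i j. \<Sigma> $$ (i, j))"
  have carr: "\<Sigma> \<in> carrier_mat p p" and tr: "\<Sigma>\<^sup>T = \<Sigma>"
    using assms(2) unfolding pos_def_mat_def by auto
  have sym: "S i j = S j i" if "i \<in> {0..<p}" "j \<in> {0..<p}" for i j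
    using that carr arg_cong[OF tr, of "\<lambda>M. M $$ (i, j)"] by (simp add: S_def)
  have sub: "submatrix \<Sigma> A A \<in> factor_model (2 * (m + 1)) m \<longleftrightarrow> factorizes m S A"
    if "A \<subseteq> {0..<p}" "card A = 2 * (m + 1)" for A
    using submatrix_factor_model_iff[OF carr that(1), of m] that(2) by (simp add: S_def)
  have full: "\<Sigma> \<in> factor_model p m \<longleftrightarrow> factorizes m S {0..<p}"
    using carr by (simp add: factor_model_iff_factorizes S_def)
  have "factorizes m S {0..<p}"
    if loc: "\<And>A. A \<subseteq> {0..<p} \<Longrightarrow> card A = 2 * (m + 1) \<Longrightarrow> factorizes m S A"
  proof -
    \<comment> \<open>The lower bound on p lets every smaller set grow to the prescribed
      size.\<close>
    have small: "factorizes m S A" if "A \<subseteq> {0..<p}" "card A \<le> 2 * (m + 1)" for A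
      using factorizes_small_subsets[OF _ _ loc that] assms(3) by simp
    consider "m = 0" | "m = 1" | "m = 2" using assms(1) by linarith
    then show ?thesis
    proof cases
      case 1 then show ?thesis using small by (auto intro: factorizes_0_local)
    next
      case 2
      show ?thesis unfolding 2 by (rule factorizes_1_local) (use small sym 2 in auto)
    next
      case 3 then show ?thesis using small sym by (auto intro: factorizes_2_local)
    qed
  qed
  then show ?thesis
    using full sub factorizes_mono by metis
qed

end
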